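(* Let $d\ge 1$ and $\mathcal X_\bullet=\{x\in\mathbb R^d:\|x\|_2\le 1\}$. For any $0<S\le 1$ and $0<c<1$ there is no (symmetric) hash that is an $(S,cS)$-LSH for the inner product similarity $\mathrm{sim}(x,y)=x^\top y$ over the pair of spaces $\mathcal X_\bullet,\mathcal Y_\bullet$ with $\mathcal Y_\bullet=\mathcal X_\bullet$.
   Context: A (symmetric) hash of a set $\mathcal Z$ is a probability distribution over functions $h:\mathcal Z\to\Gamma$, where $\Gamma$ is some set (the alphabet). For $\mathcal X,\mathcal Y\subseteq\mathcal Z$ and a similarity function $\mathrm{sim}$, a hash is an $(S,cS,p_1,p_2)$-LSH for $\mathrm{sim}$ over $\mathcal X,\mathcal Y$ if for all $x\in\mathcal X$, $y\in\mathcal Y$: (i) if $\mathrm{sim}(x,y)\ge S$ then $\mathbb P_h[h(x)=h(y)]\ge p_1$; (ii) if $\mathrm{sim}(x,y)\le cS$ then $\mathbb P_h[h(x)=h(y)]\le p_2$. It is an $(S,cS)$-LSH if there exist $p_1,p_2\in[0,1]$ with $p_1>p_2$ such that it is an $(S,cS,p_1,p_2)$-LSH. *)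

theory Defs
  imports "HOL-Probability.Probability"
begin

(* Only the values of h on Z matter, so maps Z -> \<Gamma> are taken as total functions that send
   Z into \<Gamma> (Pi), with no convention imposed outside Z. *)
definition symmetric_hash :: "'z set \<Rightarrow> 'g set \<Rightarrow> ('z \<Rightarrow> 'g) measure \<Rightarrow> bool" where
  "symmetric_hash Z \<Gamma> H \<longleftrightarrow> prob_space H \<and> space H \<subseteq> Z \<rightarrow> \<Gamma>"

definition collision :: "('z \<Rightarrow> 'g) measure \<Rightarrow> 'z \<Rightarrow> 'z \<Rightarrow> ('z \<Rightarrow> 'g) set" where
  "collision H x y = {h \<in> space H. h x = h y}"

(* Membership in sets H makes the collision probabilities meaningful: measure is 0 by
   convention on non-measurable sets. T is the lower threshold, written cS in the literature. *)
definition is_LSH_with ::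
  "('z \<Rightarrow> 'g) measure \<Rightarrow> ('z \<Rightarrow> 'z \<Rightarrow> real) \<Rightarrow> 'z set \<Rightarrow> 'z set \<Rightarrow> real \<Rightarrow> real \<Rightarrow> real \<Rightarrow> real \<Rightarrow> bool"
where
  "is_LSH_with H sim X Y S T p1 p2 \<longleftrightarrow>
     (\<forall>x\<in>X. \<forall>y\<in>Y.
        collision H x y \<in> sets H \<and>
        (sim x y \<ge> S \<longrightarrow> measure H (collision H x y) \<ge> p1) \<and>
        (sim x y \<le> T \<longrightarrow> measure H (collision H x y) \<le> p2))"

definition is_LSH ::
  "('z \<Rightarrow> 'g) measure \<Rightarrow> ('z \<Rightarrow> 'z \<Rightarrow> real) \<Rightarrow> 'z set \<Rightarrow> 'z set \<Rightarrow> real \<Rightarrow> real \<Rightarrow> bool"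
where
  "is_LSH H sim X Y S T \<longleftrightarrow>
     (\<exists>p1\<in>{0..1}. \<exists>p2\<in>{0..1}. p1 > p2 \<and> is_LSH_with H sim X Y S T p1 p2)"

definition X_bullet :: "(real ^ 'n) set" where
  "X_bullet = {x. norm x \<le> 1}"

end

theory Submission
  imports Defs
begin

(* A symmetric hash always collides on the pair (0, 0), although the similarity of 0 with
   itself is 0, which is below the threshold cS. *)

text \<open>Every function agrees with itself, so a point collides with itself with probability 1
  (\<open>measure_collision_self\<close>). A point of the ball whose self-similarity is at most
  \<open>c * S\<close> thus forces \<open>p2 \<ge> 1\<close>, against
  \<open>p2 < p1 \<le> 1\<close>. The origin is such a point.\<close>

lemma measure_collision_self:
  assumes "prob_space H"
  shows "measure H (collision H x x) = 1"
  using prob_space.prob_space[OF assms] by (simp add: collision_def)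

theorem theorem5p1:
  fixes S c :: real
  assumes "0 < S" and "S \<le> 1" and "0 < c" and "c < 1"
  shows "\<not> (\<exists>(Z :: (real ^ 'n) set) (\<Gamma> :: 'g set) H.
            X_bullet \<subseteq> Z \<and> symmetric_hash Z \<Gamma> H \<and>
            is_LSH H (\<lambda>x y. x \<bullet> y) X_bullet X_bullet S (c * S))"
proof
  assume "\<exists>(Z :: (real ^ 'n) set) (\<Gamma> :: 'g set) H.
            X_bullet \<subseteq> Z \<and> symmetric_hash Z \<Gamma> H \<and>
            is_LSH H (\<lambda>x y. x \<bullet> y) X_bullet X_bullet S (c * S)"
  then obtain H :: "(real ^ 'n \<Rightarrow> 'g) measure" and p1 p2 :: real
    where H: "prob_space H" and p: "p1 \<le> 1" "p2 < p1"
      and lsh: "is_LSH_with H (\<lambda>x y. x \<bullet> y) X_bullet X_bullet S (c * S) p1 p2"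
    unfolding symmetric_hash_def is_LSH_def by auto
  have "(0 :: real ^ 'n) \<in> X_bullet"
    by (simp add: X_bullet_def)
  \<comment> \<open>Positivity of \<open>c\<close> and \<open>S\<close> makes the origin count as
    dissimilar to itself.\<close>
  moreover have "(0 :: real ^ 'n) \<bullet> 0 \<le> c * S"
    using assms by simp
  ultimately have "measure H (collision H 0 0) \<le> p2"
    using lsh unfolding is_LSH_with_def by blast
  with measure_collision_self[OF H] p show False
    by simp
qed

end
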